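(* Let $n\ge 1$ and let $x$ be an element of the Coxeter group $W$ of type $A_n$, identified with a permutation of $\{1,\dots,n+1\}$. Then $x\in \mathrm{Edge}_n$ (i.e. $x$ is the label of some edge of some Coxeter $n$-cube in the Coxeter system of type $A_n$) if and only if $x$ is a bigrassmannian permutation.
   Context: Type $A_n$: $S=\{s_1,\dots,s_n\}$ with $m(s_i,s_{i+1})=3$ and $m(s_i,s_j)=2$ for $|i-j|\ge2$. $W$ is identified with the symmetric group on $\{1,\dots,n+1\}$, with $s_i$ the transposition $(i\ \ i+1)$. Let $(W,S)$ be a Coxeter system with Coxeter matrix $m$. Let $V$ be the real vector space with basis $\Pi=\{\alpha_s \mid s\in S\}$ (the simple roots), with symmetric bilinear form $B(\alpha_s,\alpha_{s'})=-\cos(\pi/m(s,s'))$ (equal to $-1$ if $m(s,s')=\infty$). $W$ acts on $V$ by $s(v)=v-2B(v,\alpha_s)\alpha_s$ for $s\in S$. Put $\Phi=\{w(\alpha_s)\mid w\in W, s\in S\}$, let $\Phi^+$ be the set of elements of $\Phi$ that are nonnegative linear combinations of $\Pi$, and $\Phi^-=-\Phi^+$. The left inversion set of $w\in W$ is $\Phi_w=\{\beta\in\Phi^+ \mid w^{-1}(\beta)\in\Phi^-\}$. Coxeter cubes. A Coxeter square is a quadruple $(w,x,y,z)\in (W\setminus\{1\})^4$ with $wx=yz$ and $w(\Phi_x)=\Phi_y$. It is pictured as a commutative square in which $x$ and $z$ label the two edges leaving the initial vertex, $w$ labels the edge following $x$, and $y$ labels the edge following $z$. For $n\ge1$, consider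 the oriented cube with vertex set $\{0,1\}^n$ and a directed edge $(v,i)$ from $v$ to $v+e_i$ whenever $v_i=0$ ($e_i$ the $i$-th unit vector). A Coxeter $n$-cube in $(W,S)$ is a labelling $\lambda$ of these edges by elements of $W\setminus\{1\}$ such that for all $i\ne j$ and all $v$ with $v_i=v_j=0$, the quadruple $(\lambda(v+e_i,j),\lambda(v,i),\lambda(v+e_j,i),\lambda(v,j))$ is a Coxeter square (for $n=1$ it is just one labelled edge). $\mathrm{Edge}_n$ is the set of all non-identity elements of the Coxeter group of type $A_n$ that occur as an edge label of some Coxeter $n$-cube (in any orientation) in the Coxeter system of type $A_n$. A permutation $x$ of $\{1,\dots,n+1\}$ is bigrassmannian if there is a unique ordered pair $(i,j)\in\{1,\dots,n\}^2$ such that $x(i)>x(i+1)$ and $x^{-1}(j)>x^{-1}(j+1)$. *)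

theory Defs
  imports
    Complex_Main
    "HOL-Library.Extended_Nat"
    "HOL-Algebra.Sym_Groups"
    "HOL-Algebra.Group_Action"
begin

section \<open>The geometric representation of a Coxeter system\<close>

text \<open>
  A Coxeter system is given by its group, an index set for the simple reflections, the simple
  reflections themselves and the Coxeter matrix. The definitions below only need these data,
  so the locale carries no assumptions. The element \<open>s\<close> of the index set stands for the simple
  reflection \<open>gen s\<close>.
\<close>

locale coxeter_data =
  fixes G :: "('g, 'b) monoid_scheme" (structure)
    and I :: "'i set"
    and gen :: "'i \<Rightarrow> 'g"
    and m :: "'i \<Rightarrow> 'i \<Rightarrow> enat"
begin

text \<open>
  A vector is the function giving its coordinates with respect to the simple roots:
  \<open>v\<close> stands for the sum of all \<open>v s * \<alpha>\<^sub>s\<close>.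
\<close>

definition V :: "('i \<Rightarrow> real) set" where
  "V = {v. finite {s. v s \<noteq> 0} \<and> {s. v s \<noteq> 0} \<subseteq> I}"

definition simple_root :: "'i \<Rightarrow> 'i \<Rightarrow> real" where
  "simple_root s = (\<lambda>t. if t = s then 1 else 0)"

definition gram :: "'i \<Rightarrow> 'i \<Rightarrow> real" where
  "gram s t = (case m s t of enat k \<Rightarrow> - cos (pi / real k) | \<infinity> \<Rightarrow> - 1)"

definition B :: "('i \<Rightarrow> real) \<Rightarrow> ('i \<Rightarrow> real) \<Rightarrow> real" where
  "B u v = (\<Sum>s | u s \<noteq> 0. \<Sum>t | v t \<noteq> 0. u s * v t * gram s t)"

definition refl :: "'i \<Rightarrow> ('i \<Rightarrow> real) \<Rightarrow> ('i \<Rightarrow> real)" where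
  "refl s v = (\<lambda>t. v t - 2 * B v (simple_root s) * simple_root s t)"

definition is_geometric_action :: "('g \<Rightarrow> ('i \<Rightarrow> real) \<Rightarrow> ('i \<Rightarrow> real)) \<Rightarrow> bool" where
  "is_geometric_action \<rho> \<longleftrightarrow>
     group_action G V \<rho> \<and> (\<forall>s\<in>I. \<forall>v\<in>V. \<rho> (gen s) v = refl s v)"

text \<open>
  The action is determined by the simple reflections because these generate the group;
  extensionality pins down its values outside the carrier. Existence and uniqueness in
  type A are proved at the end of this theory.
\<close>

definition act :: "'g \<Rightarrow> ('i \<Rightarrow> real) \<Rightarrow> ('i \<Rightarrow> real)" where
  "act = (THE \<rho>. \<rho> \<in> extensional (carrier G) \<and> is_geometric_action \<rho>)"

definition roots :: "('i \<Rightarrow> real) set" where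
  "roots = {act w (simple_root s) | w s. w \<in> carrier G \<and> s \<in> I}"

definition pos_roots :: "('i \<Rightarrow> real) set" where
  "pos_roots = {\<beta> \<in> roots. \<forall>s\<in>I. \<beta> s \<ge> 0}"

definition neg_roots :: "('i \<Rightarrow> real) set" where
  "neg_roots = {(\<lambda>s. - \<beta> s) | \<beta>. \<beta> \<in> pos_roots}"

definition inversions :: "'g \<Rightarrow> ('i \<Rightarrow> real) set" where
  "inversions w = {\<beta> \<in> pos_roots. act (inv w) \<beta> \<in> neg_roots}"


section \<open>Coxeter squares and cubes\<close>

definition coxeter_square :: "'g \<Rightarrow> 'g \<Rightarrow> 'g \<Rightarrow> 'g \<Rightarrow> bool" where
  "coxeter_square w x y z \<longleftrightarrow>
     {w, x, y, z} \<subseteq> carrier G - {\<one>} \<and>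
     w \<otimes> x = y \<otimes> z \<and>
     act w ` inversions x = inversions y"

end

definition cube_vertices :: "nat \<Rightarrow> (nat \<Rightarrow> nat) set" where
  "cube_vertices n = {1..n} \<rightarrow>\<^sub>E {0, 1}"

text \<open>The edge \<open>(v, i)\<close> leads from \<open>v\<close> to \<open>v(i := 1)\<close>.\<close>

definition cube_edges :: "nat \<Rightarrow> ((nat \<Rightarrow> nat) \<times> nat) set" where
  "cube_edges n = {(v, i). v \<in> cube_vertices n \<and> i \<in> {1..n} \<and> v i = 0}"

context coxeter_data
begin

definition coxeter_cube :: "nat \<Rightarrow> ((nat \<Rightarrow> nat) \<times> nat \<Rightarrow> 'g) \<Rightarrow> bool" where
  "coxeter_cube n lab \<longleftrightarrow>
     (\<forall>e\<in>cube_edges n. lab e \<in> carrier G - {\<one>}) \<and>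
     (\<forall>v\<in>cube_vertices n. \<forall>i\<in>{1..n}. \<forall>j\<in>{1..n}. i \<noteq> j \<longrightarrow> v i = 0 \<longrightarrow> v j = 0 \<longrightarrow>
        coxeter_square (lab (v(i := 1), j)) (lab (v, i)) (lab (v(j := 1), i)) (lab (v, j)))"

definition cube_labels :: "nat \<Rightarrow> 'g set" where
  "cube_labels n = {x. \<exists>lab. coxeter_cube n lab \<and> (\<exists>e\<in>cube_edges n. x = lab e)}"

end


section \<open>Type A\<close>

definition A_gen :: "nat \<Rightarrow> (nat \<Rightarrow> nat)" where
  "A_gen i = Transposition.transpose i (i + 1)"

definition A_matrix :: "nat \<Rightarrow> nat \<Rightarrow> enat" where
  "A_matrix i j = (if i = j then 1 else if j = i + 1 \<or> i = j + 1 then 3 else 2)"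

definition Edge :: "nat \<Rightarrow> (nat \<Rightarrow> nat) set" where
  "Edge n = coxeter_data.cube_labels (sym_group (n + 1)) {1..n} A_gen A_matrix n"

definition bigrassmannian :: "nat \<Rightarrow> (nat \<Rightarrow> nat) \<Rightarrow> bool" where
  "bigrassmannian n x \<longleftrightarrow>
     x permutes {1..n + 1} \<and>
     (\<exists>!p. p \<in> {1..n} \<times> {1..n} \<and>
        (case p of (i, j) \<Rightarrow> x i > x (i + 1) \<and> inv' x j > inv' x (j + 1)))"



text \<open>
  The action in type A exists and is unique. The map \<open>std\<close> realises the simple root \<open>i\<close> as
  \<open>e\<^sub>i - e\<^sub>i\<^sub>+\<^sub>1\<close>; there, permutations act by permuting coordinates.
\<close>

definition std :: "(nat \<Rightarrow> real) \<Rightarrow> nat \<Rightarrow> real" where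
  "std v k = v k - v (k - 1)"

definition perm_act :: "nat \<Rightarrow> (nat \<Rightarrow> nat) \<Rightarrow> (nat \<Rightarrow> real) \<Rightarrow> (nat \<Rightarrow> real)" where
  "perm_act n w v = (\<lambda>i. if i \<in> {1..n} then \<Sum>k=1..i. std v (inv' w k) else 0)"

context
  fixes n :: nat
  notes One_nat_def [simp del]
begin

interpretation A: coxeter_data "sym_group (n + 1)" "{1..n}" A_gen A_matrix .

lemma A_V_iff: "v \<in> A.V \<longleftrightarrow> (\<forall>i. i \<notin> {1..n} \<longrightarrow> v i = 0)"
proof
  assume *: "\<forall>i. i \<notin> {1..n} \<longrightarrow> v i = 0"
  then have "{s. v s \<noteq> 0} \<subseteq> {1..n}" by blast
  then show "v \<in> A.V" unfolding A.V_def by (auto intro: finite_subset)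
qed (auto simp: A.V_def)

lemma sum_std: "v 0 = 0 \<Longrightarrow> (\<Sum>k=1..i. std v k) = v i"
  by (induction i) (auto simp: std_def)

lemma std_inject:
  assumes "u \<in> A.V" "v \<in> A.V" "\<And>k. k \<in> {1..n} \<Longrightarrow> std u k = std v k"
  shows "u = v"
proof
  fix i
  have z: "u 0 = 0" "v 0 = 0" using assms by (auto simp: A_V_iff)
  show "u i = v i"
  proof (cases "i \<in> {1..n}")
    case True
    have "(\<Sum>k=1..i. std u k) = (\<Sum>k=1..i. std v k)"
      using True by (intro sum.cong assms) auto
    then show ?thesis using z sum_std by simp
  next
    case False
    then show ?thesis using assms by (simp add: A_V_iff)
  qed
qed

lemma perm_act_V: "perm_act n w v \<in> A.V"
  by (simp add: A_V_iff perm_act_def)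

lemma std_perm_act:
  assumes v: "v \<in> A.V" and w: "w permutes {1..n + 1}" and k: "k \<in> {1..n + 1}"
  shows "std (perm_act n w v) k = std v (inv' w k)"
proof -
  have tot: "(\<Sum>k=1..n + 1. std v (inv' w k)) = 0"
  proof -
    have "(\<Sum>k=1..n + 1. std v (inv' w k)) = (\<Sum>k=1..n + 1. std v k)"
      using sum.permute[OF permutes_inv[OF w], of "std v"] by (simp add: o_def)
    also have "\<dots> = v (n + 1)" using v by (intro sum_std) (simp add: A_V_iff)
    finally show ?thesis using v by (simp add: A_V_iff)
  qed
  have val: "perm_act n w v i = (\<Sum>k=1..i. std v (inv' w k))" if "i \<le> n + 1" for i
  proof -
    consider "i = 0" | "i \<in> {1..n}" | "i = n + 1" using \<open>i \<le> n + 1\<close> by fastforce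
    then show ?thesis using tot by cases (auto simp: perm_act_def)
  qed
  obtain j where j: "k = Suc j" using k by (cases k) auto
  show ?thesis using k val[of k] val[of j] unfolding j by (simp add: std_def)
qed

lemma perm_act_comp:
  assumes v: "v \<in> A.V" and w: "w permutes {1..n + 1}" and x: "x permutes {1..n + 1}"
  shows "perm_act n (w \<circ> x) v = perm_act n w (perm_act n x v)"
proof (rule std_inject)
  fix k assume "k \<in> {1..n}"
  then have k: "k \<in> {1..n + 1}" by simp
  have "inv' w k \<in> {1..n + 1}" using permutes_in_image[OF permutes_inv[OF w]] k by blast
  moreover have "inv' (w \<circ> x) k = inv' x (inv' w k)"
    using w x by (simp add: o_inv_distrib permutes_bij)
  ultimately show "std (perm_act n (w \<circ> x) v) k = std (perm_act n w (perm_act n x v)) k"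
    using k v w x by (simp add: std_perm_act perm_act_V permutes_compose)
qed (rule perm_act_V)+

lemma perm_act_id: "v \<in> A.V \<Longrightarrow> perm_act n id v = v"
  by (rule std_inject) (auto simp: perm_act_V std_perm_act permutes_id)

lemma A_B:
  assumes v: "v \<in> A.V" and i: "i \<in> {1..n}"
  shows "2 * A.B v (A.simple_root i) = std v i - std v (i + 1)"
proof -
  have g: "A.gram s i = (if s = i then 1 else if s = i + 1 \<or> s + 1 = i then - (1 / 2) else 0)" for s
    by (auto simp: A.gram_def A_matrix_def one_enat_def numeral_eq_enat cos_60)
  have "A.B v (A.simple_root i) = (\<Sum>s | v s \<noteq> 0. v s * A.gram s i)"
    by (simp add: A.B_def A.simple_root_def)
  also have "\<dots> = (\<Sum>s\<in>{..n + 1}. v s * A.gram s i)"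
  proof (intro sum.mono_neutral_left)
    show "{s. v s \<noteq> 0} \<subseteq> {..n + 1}"
      proof
      fix s assume "s \<in> {s. v s \<noteq> 0}"
      then have "s \<in> {1..n}" using v by (auto simp: A.V_def)
      then show "s \<in> {..n + 1}" by simp
    qed
  qed auto
  also have "\<dots> = (\<Sum>s\<in>{i - 1, i, i + 1}. v s * A.gram s i)"
    using i by (intro sum.mono_neutral_right) (auto simp: g)
  also have "\<dots> = v i - v (i - 1) / 2 - v (i + 1) / 2"
  proof -
    have "i - 1 \<noteq> i" "i - 1 + 1 = i" using i by auto
    then show ?thesis by (simp add: g)
  qed
  finally show ?thesis using i by (simp add: std_def)
qed

lemma A_gen_permutes: "i \<in> {1..n} \<Longrightarrow> A_gen i permutes {1..n + 1}"
  unfolding A_gen_def by (rule permutes_swap_id) auto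

lemma perm_act_gen:
  assumes v: "v \<in> A.V" and i: "i \<in> {1..n}"
  shows "perm_act n (A_gen i) v = A.refl i v"
proof (rule std_inject)
  show "A.refl i v \<in> A.V" using v i by (auto simp: A_V_iff A.refl_def A.simple_root_def)
next
  fix k assume k: "k \<in> {1..n}"
  have "inv' (A_gen i) k = A_gen i k" by (simp add: A_gen_def)
  then have "std (perm_act n (A_gen i) v) k = std v (A_gen i k)"
    using k by (simp add: std_perm_act[OF v A_gen_permutes[OF i]])
  also have "\<dots> = std (A.refl i v) k"
    using i k A_B[OF v i]
    by (auto simp: A_gen_def Transposition.transpose_def A.refl_def A.simple_root_def std_def)
  finally show "std (perm_act n (A_gen i) v) k = std (A.refl i v) k" .
qed (rule perm_act_V)

lemma A_action_exists:
  "A.is_geometric_action (\<lambda>w\<in>carrier (sym_group (n + 1)). \<lambda>v\<in>A.V. perm_act n w v)"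
    (is "A.is_geometric_action ?\<rho>")
proof -
  have bij: "(\<lambda>v\<in>A.V. perm_act n w v) \<in> Bij A.V" if w: "w permutes {1..n + 1}" for w
  proof -
    have "bij_betw (perm_act n w) A.V A.V"
    proof (rule bij_betw_byWitness[where f' = "perm_act n (inv' w)"])
      show "\<forall>v\<in>A.V. perm_act n (inv' w) (perm_act n w v) = v"
        using perm_act_comp[OF _ permutes_inv[OF w] w] perm_act_id permutes_inv_o[OF w] by metis
      show "\<forall>v\<in>A.V. perm_act n w (perm_act n (inv' w) v) = v"
        using perm_act_comp[OF _ w permutes_inv[OF w]] perm_act_id permutes_inv_o[OF w] by metis
    qed (auto simp: perm_act_V)
    then show ?thesis by (simp add: Bij_def)
  qed
  have "?\<rho> \<in> hom (sym_group (n + 1)) (BijGroup A.V)"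
  proof (rule homI)
    fix w assume "w \<in> carrier (sym_group (n + 1))"
    then show "?\<rho> w \<in> carrier (BijGroup A.V)"
      using bij by (simp add: BijGroup_def sym_group_carrier)
  next
    fix w x assume "w \<in> carrier (sym_group (n + 1))" "x \<in> carrier (sym_group (n + 1))"
    then have wx: "w permutes {1..n + 1}" "x permutes {1..n + 1}"
      by (simp_all only: sym_group_carrier)
    then have "w \<circ> x permutes {1..n + 1}" by (simp only: permutes_compose)
    then show "?\<rho> (w \<otimes>\<^bsub>sym_group (n + 1)\<^esub> x) = ?\<rho> w \<otimes>\<^bsub>BijGroup A.V\<^esub> ?\<rho> x"
      using wx bij perm_act_comp
      by (auto simp: fun_eq_iff BijGroup_def sym_group_carrier sym_group_mult compose_def perm_act_V)
  qed
  then have "group_action (sym_group (n + 1)) A.V ?\<rho>"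
    by (intro group_action.intro group_hom.intro group_hom_axioms.intro
        sym_group_is_group group_BijGroup)
  then show ?thesis
    using A_gen_permutes perm_act_gen
    by (auto simp: A.is_geometric_action_def sym_group_carrier)
qed

lemma A_gen_induct [consumes 1, case_names id gen comp]:
  assumes w: "w permutes {1..n + 1}"
    and id: "P id"
    and gen: "\<And>i. i \<in> {1..n} \<Longrightarrow> P (A_gen i)"
    and comp: "\<And>w x. w permutes {1..n + 1} \<Longrightarrow> x permutes {1..n + 1} \<Longrightarrow> P w \<Longrightarrow> P x \<Longrightarrow> P (w \<circ> x)"
  shows "P w"
proof -
  have tr: "a + d + 1 \<le> n + 1 \<Longrightarrow> P (Transposition.transpose a (a + d + 1))" if "1 \<le> a" for a d
  proof (induction d)
    case 0
    then show ?case using gen[of a] that by (simp add: A_gen_def)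
  next
    case (Suc d)
    let ?s = "A_gen (a + d + 1)" and ?t = "Transposition.transpose a (a + d + 1)"
    have st: "?s permutes {1..n + 1}" "?t permutes {1..n + 1}"
      using Suc.prems that by (auto intro!: A_gen_permutes permutes_swap_id)
    have "P (?s \<circ> (?t \<circ> ?s))"
      using Suc st gen[of "a + d + 1"] by (intro comp permutes_compose) auto
    moreover have "?s \<circ> (?t \<circ> ?s) = Transposition.transpose a (a + Suc d + 1)"
      by (auto simp: fun_eq_iff A_gen_def Transposition.transpose_def)
    ultimately show ?case by simp
  qed
  have tr': "P (Transposition.transpose a b)" if "a \<in> {1..n + 1}" "b \<in> {1..n + 1}" for a b
  proof (cases a b rule: linorder_cases)
    case less
    then show ?thesis using tr[of a "b - a - 1"] that by simp
  next
    case equal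
    then show ?thesis using id by simp
  next
    case greater
    then show ?thesis using tr[of b "a - b - 1"] that by (simp add: Transposition.transpose_commute)
  qed
  show ?thesis
  proof (rule permutes_induct[OF w])
    show "P id" by (rule id)
    show "P (Transposition.transpose a b \<circ> p)"
      if "a \<in> {1..n + 1}" "b \<in> {1..n + 1}" "P p" "a \<noteq> b" "p permutes {1..n + 1}" for a b p
      using that by (intro comp tr' permutes_swap_id)
  qed simp
qed

lemma A_action_unique:
  assumes "A.is_geometric_action \<rho>" "A.is_geometric_action \<rho>'" "w permutes {1..n + 1}"
  shows "\<rho> w = \<rho>' w"
proof -
  let ?G = "sym_group (n + 1)"
  interpret a: group_action ?G A.V \<rho> using assms by (simp add: A.is_geometric_action_def)
  interpret b: group_action ?G A.V \<rho>' using assms by (simp add: A.is_geometric_action_def)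
  have h: "\<rho> \<in> hom ?G (BijGroup A.V)" "\<rho>' \<in> hom ?G (BijGroup A.V)"
    using a.group_hom b.group_hom by (simp_all add: group_hom_def group_hom_axioms_def)
  show ?thesis using assms(3)
  proof (induction rule: A_gen_induct)
    case id
    then show ?case using a.id_eq_one b.id_eq_one unfolding sym_group_one by (rule trans[OF sym])
  next
    case (gen i)
    then have "A_gen i \<in> carrier ?G" using A_gen_permutes by (simp add: sym_group_carrier)
    then have "\<rho> (A_gen i) \<in> extensional A.V" "\<rho>' (A_gen i) \<in> extensional A.V"
      using a.bij_prop0 b.bij_prop0 by (auto simp: Bij_def)
    then show ?case using assms gen by (auto simp: A.is_geometric_action_def intro: extensionalityI)
  next
    case (comp w x)
    then have "w \<in> carrier ?G" "x \<in> carrier ?G" by (simp_all only: sym_group_carrier)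
    then show ?case using comp hom_mult[OF h(1)] hom_mult[OF h(2)] by (metis sym_group_mult)
  qed
qed

theorem A_action_ex1:
  "\<exists>!\<rho>. \<rho> \<in> extensional (carrier (sym_group (n + 1))) \<and> A.is_geometric_action \<rho>"
proof (rule ex_ex1I)
  show "\<exists>\<rho>. \<rho> \<in> extensional (carrier (sym_group (n + 1))) \<and> A.is_geometric_action \<rho>"
    using A_action_exists restrict_extensional by blast
next
  fix \<rho> \<rho>'
  assume *: "\<rho> \<in> extensional (carrier (sym_group (n + 1))) \<and> A.is_geometric_action \<rho>"
    "\<rho>' \<in> extensional (carrier (sym_group (n + 1))) \<and> A.is_geometric_action \<rho>'"
  show "\<rho> = \<rho>'"
  proof (rule extensionalityI)
    fix w assume "w \<in> carrier (sym_group (n + 1))"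
    then show "\<rho> w = \<rho>' w" using * A_action_unique by (simp add: sym_group_carrier)
  qed (use * in blast)+
qed

corollary A_act_eq:
  "A.act = (\<lambda>w\<in>carrier (sym_group (n + 1)). \<lambda>v\<in>A.V. perm_act n w v)"
  unfolding A.act_def
  by (rule the1_equality[OF A_action_ex1]) (use A_action_exists restrict_extensional in blast)

end

end

theory Submission
  imports Defs
begin

text \<open>
  In type A the root attached to \<open>p \<noteq> q\<close> is \<open>e\<^sub>p - e\<^sub>q\<close>, and a permutation acts on roots by acting on
  the two indices (\<open>act_root_vec\<close>). Hence left inversion sets become sets \<open>inv_pairs\<close> of pairs
  \<open>p < q\<close>, and Coxeter squares become a statement about permutations alone
  (\<open>coxeter_square_iff\<close>).

  Labels are bigrassmannian. At a vertex of a Coxeter \<open>n\<close>-cube, read each of the \<open>n\<close> incident edges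
  towards the vertex, inverting the label if the edge leaves it. The four corners of a Coxeter
  square show that the inversion sets of these \<open>n\<close> permutations are pairwise disjoint
  (\<open>labels_towards_disjoint\<close>). Each permutation is nontrivial, so its inversion set contains a
  simple root; there are only \<open>n\<close> simple roots, so each inversion set contains exactly one. Thus each
  permutation has a unique left descent (\<open>label_towards_unique_descent\<close>). Applied at both ends of
  an edge labelled \<open>x\<close>, this gives a unique left descent of \<open>x\<close> and of its inverse.

  Bigrassmannian permutations are labels. A bigrassmannian permutation exchanges two adjacent
  blocks, so its inversion set is a rectangle: all \<open>(p, q)\<close> with \<open>s \<le> p \<le> j < q \<le> t\<close>
  (\<open>bigrassmannian_rectangle\<close>). Take a binary tree with the leaves \<open>1, ..., n + 1\<close> in this order in
  which some node has leaf set \<open>s, ..., t\<close> and separates \<open>s, ..., j\<close> from \<open>j + 1, ..., t\<close>. It has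
  \<open>n\<close> inner nodes, one between any two neighbouring leaves. Exchanging the two children at all nodes
  of a set \<open>T\<close> rearranges the leaves, and these \<open>2\<^sup>n\<close> arrangements are the vertices of a Coxeter
  \<open>n\<close>-cube. The edge that undoes the single exchange at the chosen node has the given label
  (\<open>edge_label_of_separation\<close>).
\<close>


section \<open>Permutations and the orders they induce\<close>

text \<open>
  The permutation maps the indices counted here bijectively onto the initial segment that ends at
  \<open>f p\<close>. So a permutation is determined by the order in which it arranges the indices.
\<close>

lemma permutes_eq_card:
  fixes f :: "nat \<Rightarrow> nat"
  assumes f: "f permutes {1..m}" and p: "p \<in> {1..m}"
  shows "f p = card {q \<in> {1..m}. f q \<le> f p}"
proof -
  have fp: "f p \<in> {1..m}" using permutes_in_image[OF f] p by blast
  have "f ` {q \<in> {1..m}. f q \<le> f p} = {1..f p}"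
  proof (intro equalityI subsetI)
    fix k assume "k \<in> f ` {q \<in> {1..m}. f q \<le> f p}"
    then show "k \<in> {1..f p}" using permutes_in_image[OF f] by fastforce
  next
    fix k assume k: "k \<in> {1..f p}"
    then have "k \<in> f ` {1..m}" using fp permutes_image[OF f] by auto
    then show "k \<in> f ` {q \<in> {1..m}. f q \<le> f p}" using k by auto
  qed
  moreover have "inj_on f {q \<in> {1..m}. f q \<le> f p}"
    using permutes_inj[OF f] by (rule inj_on_subset) simp
  ultimately show ?thesis using card_image by fastforce
qed

lemma permutes_eqI_order:
  fixes f g :: "nat \<Rightarrow> nat"
  assumes f: "f permutes {1..m}" and g: "g permutes {1..m}"
    and fg: "\<And>p q. p \<in> {1..m} \<Longrightarrow> q \<in> {1..m} \<Longrightarrow> p < q \<Longrightarrow> f q < f p \<longleftrightarrow> g q < g p"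
  shows "f = g"
proof
  fix p
  show "f p = g p"
  proof (cases "p \<in> {1..m}")
    case True
    have "f q \<le> f p \<longleftrightarrow> g q \<le> g p" if "q \<in> {1..m}" for q
    proof (cases q p rule: linorder_cases)
      case less
      then show ?thesis using fg[OF that True] by auto
    next
      case equal
      then show ?thesis by simp
    next
      case greater
      have "f q \<noteq> f p" "g q \<noteq> g p"
        using greater permutes_inj[OF f] permutes_inj[OF g] by (simp_all add: inj_eq)
      then show ?thesis using fg[OF True that] greater by auto
    qed
    then have "{q \<in> {1..m}. f q \<le> f p} = {q \<in> {1..m}. g q \<le> g p}" by blast
    then show ?thesis using permutes_eq_card[OF f True] permutes_eq_card[OF g True] by simp
  next
    case False
    then show ?thesis using f g by (simp add: permutes_not_in)
  qed
qed

lemma less_if_no_descent: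
  fixes f :: "nat \<Rightarrow> nat"
  assumes f: "inj f" and nd: "\<And>k. a \<le> k \<Longrightarrow> k < b \<Longrightarrow> \<not> f (k + 1) < f k"
    and pq: "a \<le> p" "p < q" "q \<le> b"
  shows "f p < f q"
  using pq
proof (induction q)
  case (Suc q)
  have "f q \<noteq> f (Suc q)" using f by (metis injD n_not_Suc_n)
  then have "f q < f (Suc q)" using nd[of q] Suc.prems by simp
  then show ?case using Suc by (cases "p = q") auto
qed simp

lemma permutes_has_descent:
  fixes f :: "nat \<Rightarrow> nat"
  assumes f: "f permutes {1..n + 1}" and "f \<noteq> id"
  shows "\<exists>k\<in>{1..n}. f (k + 1) < f k"
proof (rule ccontr)
  assume "\<not> ?thesis"
  then have "f p < f q" if "1 \<le> p" "p < q" "q \<le> n + 1" for p q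
    using that by (intro less_if_no_descent[OF permutes_inj[OF f], of 1 "n + 1"]) auto
  then have "f = id"
    by (intro permutes_eqI_order[OF f permutes_id]) (metis atLeastAtMost_iff id_apply less_asym)
  then show False using \<open>f \<noteq> id\<close> by simp
qed

text \<open>The permutation sends an index to its rank in the given strict linear order.\<close>

lemma ex_permutes_of_order:
  fixes R :: "nat \<Rightarrow> nat \<Rightarrow> bool"
  assumes irrefl: "\<And>p. \<not> R p p"
    and trans: "\<And>p q r. p \<in> {1..m} \<Longrightarrow> q \<in> {1..m} \<Longrightarrow> r \<in> {1..m} \<Longrightarrow> R p q \<Longrightarrow> R q r \<Longrightarrow> R p r"
    and total: "\<And>p q. p \<in> {1..m} \<Longrightarrow> q \<in> {1..m} \<Longrightarrow> p \<noteq> q \<Longrightarrow> R p q \<or> R q p"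
  shows "\<exists>f. f permutes {1..m} \<and> (\<forall>p\<in>{1..m}. \<forall>q\<in>{1..m}. f p < f q \<longleftrightarrow> R p q)"
proof -
  define D where "D p = {q \<in> {1..m}. q = p \<or> R q p}" for p
  define f where "f p = (if p \<in> {1..m} then card (D p) else p)" for p
  have fin: "finite (D p)" for p by (simp add: D_def)
  have mono: "f p < f q" if "p \<in> {1..m}" "q \<in> {1..m}" "R p q" for p q
  proof -
    have "q \<notin> D p" using that irrefl trans unfolding D_def by blast
    moreover have "q \<in> D q" using that by (simp add: D_def)
    moreover have "D p \<subseteq> D q" using that trans unfolding D_def by blast
    ultimately have "card (D p) < card (D q)" by (intro psubset_card_mono fin) auto
    then show ?thesis using that by (simp add: f_def)
  qed
  have iff: "f p < f q \<longleftrightarrow> R p q" if "p \<in> {1..m}" "q \<in> {1..m}" for p q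
    using mono[OF that] mono[OF that(2,1)] total[OF that] by (metis less_asym less_irrefl)
  have inj: "inj_on f {1..m}"
    by (intro inj_onI) (metis mono total less_irrefl)
  have "f ` {1..m} \<subseteq> {1..m}"
  proof (intro image_subsetI)
    fix p assume p: "p \<in> {1..m}"
    have "card (D p) \<le> card {1..m}" by (intro card_mono) (auto simp: D_def)
    moreover have "card (D p) \<noteq> 0" using p fin by (auto simp: D_def)
    ultimately show "f p \<in> {1..m}" using p by (simp add: f_def)
  qed
  then have "bij_betw f {1..m} {1..m}"
    using inj by (simp add: bij_betw_def endo_inj_surj)
  then have "f permutes {1..m}"
    by (rule bij_imp_permutes) (simp add: f_def del: atLeastAtMost_iff)
  then show ?thesis using iff by blast
qed


text \<open>
  The union of the sets has at least as many elements as there are sets, with equality only if all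
  of them are singletons, and there is no room for more.
\<close>

lemma card_eq_1_if_disjoint:
  fixes D :: "'a \<Rightarrow> 'b set"
  assumes fin: "finite I" "finite K" and card: "card I = card K"
    and sub: "\<And>i. i \<in> I \<Longrightarrow> D i \<subseteq> K"
    and nonempty: "\<And>i. i \<in> I \<Longrightarrow> D i \<noteq> {}"
    and disjoint: "\<And>i j. i \<in> I \<Longrightarrow> j \<in> I \<Longrightarrow> i \<noteq> j \<Longrightarrow> D i \<inter> D j = {}"
    and i: "i \<in> I"
  shows "card (D i) = 1"
proof (rule ccontr)
  have finD: "finite (D i)" if "i \<in> I" for i using sub[OF that] fin by (auto intro: finite_subset)
  have ge: "1 \<le> card (D i)" if "i \<in> I" for i
    using nonempty[OF that] finD[OF that] by (simp add: Suc_leI card_gt_0_iff)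
  assume "card (D i) \<noteq> 1"
  then have "1 < card (D i)" using ge[OF i] by simp
  then have "(\<Sum>i\<in>I. 1) < (\<Sum>i\<in>I. card (D i))"
    using fin ge i by (intro sum_strict_mono_ex1) auto
  also have "\<dots> = card (\<Union>i\<in>I. D i)"
    using fin finD disjoint by (intro card_UN_disjoint[symmetric]) auto
  also have "\<dots> \<le> card K" using fin sub by (intro card_mono) auto
  finally show False using card by simp
qed


section \<open>Roots and Coxeter squares in type A\<close>

text \<open>
  The root \<open>e\<^sub>p - e\<^sub>q\<close> in coordinates with respect to the simple roots \<open>e\<^sub>i - e\<^sub>i\<^sub>+\<^sub>1\<close>. For \<open>p < q\<close> these
  coordinates are the indicator function of \<open>p \<le> i < q\<close>.
\<close>

definition root_vec :: "nat \<Rightarrow> nat \<Rightarrow> nat \<Rightarrow> real" where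
  "root_vec p q = (\<lambda>i. (if p \<le> i then 1 else 0) - (if q \<le> i then 1 else 0))"

text \<open>The left inversion set, with the positive root \<open>root_vec p q\<close> replaced by the pair \<open>(p, q)\<close>.\<close>

definition inv_pairs :: "nat \<Rightarrow> (nat \<Rightarrow> nat) \<Rightarrow> (nat \<times> nat) set" where
  "inv_pairs m w = {(p, q). p \<in> {1..m} \<and> q \<in> {1..m} \<and> p < q \<and> inv' w q < inv' w p}"

context
  fixes n :: nat
  notes One_nat_def [simp del]
begin

interpretation A: coxeter_data "sym_group (n + 1)" "{1..n}" A_gen A_matrix .

lemma root_vec_V: "p \<in> {1..n + 1} \<Longrightarrow> q \<in> {1..n + 1} \<Longrightarrow> root_vec p q \<in> A.V"
  by (auto simp: A_V_iff root_vec_def)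

lemma std_root_vec:
  "k \<ge> 1 \<Longrightarrow> std (root_vec p q) k = (if k = p then 1 else 0) - (if k = q then 1 else 0)"
  by (auto simp: std_def root_vec_def)

lemma act_root_vec:
  assumes w: "w permutes {1..n + 1}" and p: "p \<in> {1..n + 1}" and q: "q \<in> {1..n + 1}"
  shows "A.act w (root_vec p q) = root_vec (w p) (w q)"
proof -
  have "perm_act n w (root_vec p q) = root_vec (w p) (w q)"
  proof (rule std_inject)
    have wpq: "w p \<in> {1..n + 1}" "w q \<in> {1..n + 1}"
      using permutes_in_image[OF w] p q by blast+
    show "root_vec (w p) (w q) \<in> coxeter_data.V {1..n}" by (intro root_vec_V wpq)
    fix k assume "k \<in> {1..n}"
    then have k: "k \<in> {1..n + 1}" by simp
    have "inv' w k \<in> {1..n + 1}" using permutes_in_image[OF permutes_inv[OF w]] k by blast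
    moreover have "inv' w k = r \<longleftrightarrow> k = w r" for r
      using permutes_inv_eq[OF w] by metis
    ultimately show "std (perm_act n w (root_vec p q)) k = std (root_vec (w p) (w q)) k"
      using k by (simp add: std_perm_act[OF root_vec_V[OF p q] w k] std_root_vec)
  qed (rule perm_act_V)
  moreover have "w \<in> carrier (sym_group (n + 1))" using w by (simp only: sym_group_carrier)
  ultimately show ?thesis using root_vec_V[OF p q] by (simp add: A_act_eq)
qed

lemma roots_eq: "A.roots = {root_vec p q | p q. p \<in> {1..n + 1} \<and> q \<in> {1..n + 1} \<and> p \<noteq> q}"
proof (intro equalityI subsetI)
  have simple: "A.simple_root i = root_vec i (i + 1)" for i
    by (auto simp: A.simple_root_def root_vec_def)
  fix \<beta>
  {
    assume "\<beta> \<in> A.roots"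
    then obtain w i where w: "w permutes {1..n + 1}" and i: "i \<in> {1..n}"
      and \<beta>: "\<beta> = A.act w (A.simple_root i)"
      unfolding A.roots_def by (auto simp only: sym_group_carrier)
    have "\<beta> = root_vec (w i) (w (i + 1))"
      using act_root_vec[OF w, of i "i + 1"] i by (simp add: \<beta> simple)
    moreover have "w i \<in> {1..n + 1}" "w (i + 1) \<in> {1..n + 1}"
      using permutes_in_image[OF w] i by auto
    moreover have "w i \<noteq> w (i + 1)" using permutes_inj[OF w] by (simp add: inj_eq)
    ultimately show "\<beta> \<in> {root_vec p q | p q. p \<in> {1..n + 1} \<and> q \<in> {1..n + 1} \<and> p \<noteq> q}"
      by blast
  next
    assume "\<beta> \<in> {root_vec p q | p q. p \<in> {1..n + 1} \<and> q \<in> {1..n + 1} \<and> p \<noteq> q}"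
    then obtain p q where p: "p \<in> {1..n + 1}" and q: "q \<in> {1..n + 1}" and "p \<noteq> q"
      and \<beta>: "\<beta> = root_vec p q" by blast
    have n: "1 \<in> {1..n}" using p q \<open>p \<noteq> q\<close> by auto
    \<comment> \<open>The Weyl group moves the simple root of index 1 to any root: \<open>t\<close> fixes 1 and takes 2 to the
      index that the transposition of 1 and \<open>p\<close> sends to \<open>q\<close>.\<close>
    define t where "t = Transposition.transpose 2 (Transposition.transpose 1 p q)"
    define w where "w = Transposition.transpose 1 p \<circ> t"
    have q': "Transposition.transpose 1 p q \<in> {1..n + 1} - {1}"
      using p q \<open>p \<noteq> q\<close> by (auto simp: Transposition.transpose_def)
    have w: "w permutes {1..n + 1}"
      unfolding w_def t_def using n p q' by (intro permutes_compose permutes_swap_id) auto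
    have "w 1 = p" "w (1 + 1) = q"
      using q' by (auto simp: w_def t_def)
    then have "A.act w (A.simple_root 1) = \<beta>"
      using act_root_vec[OF w, of 1 "1 + 1"] n by (simp add: \<beta> simple)
    then show "\<beta> \<in> A.roots"
      unfolding A.roots_def using w n by (auto simp only: sym_group_carrier)
  }
qed

lemma root_vec_nonneg_iff:
  assumes "p \<in> {1..n + 1}" "q \<in> {1..n + 1}" "p \<noteq> q"
  shows "(\<forall>i\<in>{1..n}. root_vec p q i \<ge> 0) \<longleftrightarrow> p < q"
proof
  assume *: "\<forall>i\<in>{1..n}. root_vec p q i \<ge> 0"
  show "p < q"
  proof (rule ccontr)
    assume "\<not> p < q"
    then have "q \<in> {1..n}" "root_vec p q q = - 1" using assms by (auto simp: root_vec_def)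
    then show False using * by fastforce
  qed
qed (auto simp: root_vec_def)

lemma pos_roots_eq: "A.pos_roots = {root_vec p q | p q. p \<in> {1..n + 1} \<and> q \<in> {1..n + 1} \<and> p < q}"
  unfolding A.pos_roots_def roots_eq using root_vec_nonneg_iff by (auto; metis less_irrefl)

lemma neg_roots_eq: "A.neg_roots = {root_vec p q | p q. p \<in> {1..n + 1} \<and> q \<in> {1..n + 1} \<and> q < p}"
proof (intro equalityI subsetI)
  have minus: "(\<lambda>s. - root_vec p q s) = root_vec q p" for p q by (auto simp: root_vec_def)
  fix \<gamma>
  {
    assume "\<gamma> \<in> A.neg_roots"
    then obtain p q where "p \<in> {1..n + 1}" "q \<in> {1..n + 1}" "p < q"
      and "\<gamma> = (\<lambda>s. - root_vec p q s)"
      unfolding A.neg_roots_def pos_roots_eq by blast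
    then show "\<gamma> \<in> {root_vec p q | p q. p \<in> {1..n + 1} \<and> q \<in> {1..n + 1} \<and> q < p}"
      unfolding minus by blast
  next
    assume "\<gamma> \<in> {root_vec p q | p q. p \<in> {1..n + 1} \<and> q \<in> {1..n + 1} \<and> q < p}"
    then obtain p q where pq: "p \<in> {1..n + 1}" "q \<in> {1..n + 1}" "q < p" and \<gamma>: "\<gamma> = root_vec p q"
      by blast
    have "root_vec q p \<in> A.pos_roots" unfolding pos_roots_eq using pq by blast
    moreover have "\<gamma> = (\<lambda>s. - root_vec q p s)" by (simp only: \<gamma> minus)
    ultimately show "\<gamma> \<in> A.neg_roots" unfolding A.neg_roots_def by blast
  }
qed

lemma root_vec_inject:
  assumes "p \<in> {1..n + 1}" "q \<in> {1..n + 1}" "p \<noteq> q"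
    and "p' \<in> {1..n + 1}" "q' \<in> {1..n + 1}"
    and eq: "root_vec p q = root_vec p' q'"
  shows "p = p' \<and> q = q'"
proof -
  have "std (root_vec p q) k = std (root_vec p' q') k" for k by (simp add: eq)
  from this[of p] this[of q] show ?thesis
    using assms(1-5) by (auto simp: std_root_vec split: if_splits)
qed

lemma inversions_eq:
  assumes w: "w permutes {1..n + 1}"
  shows "A.inversions w = (\<lambda>(p, q). root_vec p q) ` inv_pairs (n + 1) w"
proof -
  have wi: "inv' w permutes {1..n + 1}" by (rule permutes_inv[OF w])
  have inv_eq: "inv\<^bsub>sym_group (n + 1)\<^esub> w = inv' w"
    using w by (intro sym_group_inv_equality) (simp only: sym_group_carrier)
  have neg: "A.act (inv' w) (root_vec p q) \<in> A.neg_roots \<longleftrightarrow> inv' w q < inv' w p"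
    if pq: "p \<in> {1..n + 1}" "q \<in> {1..n + 1}" "p < q" for p q
  proof -
    have in_range: "inv' w p \<in> {1..n + 1}" "inv' w q \<in> {1..n + 1}"
      using permutes_in_image[OF wi] pq by blast+
    have ne: "inv' w p \<noteq> inv' w q" using permutes_inj[OF wi] pq by (simp add: inj_eq)
    show ?thesis
      unfolding act_root_vec[OF wi pq(1,2)] neg_roots_eq
      using in_range root_vec_inject[OF in_range ne] by blast
  qed
  show ?thesis
    unfolding A.inversions_def inv_eq pos_roots_eq inv_pairs_def using neg by auto
qed

lemma nontrivial_elements:
  "carrier (sym_group (n + 1)) - {\<one>\<^bsub>sym_group (n + 1)\<^esub>} = {f. f permutes {1..n + 1} \<and> f \<noteq> id}"
  unfolding set_eq_iff Diff_iff sym_group_carrier sym_group_one singleton_iff mem_Collect_eq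
  by (intro allI refl)

text \<open>
  Roots with different index pairs are different vectors, so the equation between images of root
  sets can be checked on pairs.
\<close>

lemma coxeter_square_iff:
  "A.coxeter_square w x y z \<longleftrightarrow>
     (\<forall>f\<in>{w, x, y, z}. f permutes {1..n + 1} \<and> f \<noteq> id) \<and> w \<circ> x = y \<circ> z \<and>
     map_prod w w ` inv_pairs (n + 1) x = inv_pairs (n + 1) y"
proof (cases "\<forall>f\<in>{w, x, y, z}. f permutes {1..n + 1} \<and> f \<noteq> id")
  case True
  let ?r = "\<lambda>(p, q). root_vec p q"
  let ?P = "{(p, q). p \<in> {1..n + 1} \<and> q \<in> {1..n + 1} \<and> p \<noteq> q}"
  from True have w: "w permutes {1..n + 1}" and x: "x permutes {1..n + 1}"
    and y: "y permutes {1..n + 1}" by auto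
  have inj: "inj_on ?r ?P"
  proof (rule inj_onI)
    fix a b assume *: "a \<in> ?P" "b \<in> ?P" "?r a = ?r b"
    obtain p q p' q' where "a = (p, q)" "b = (p', q')" by (metis surj_pair)
    then show "a = b" using * root_vec_inject[of p q p' q'] by auto
  qed
  have sub: "inv_pairs (n + 1) f \<subseteq> ?P" for f by (auto simp: inv_pairs_def)
  have subw: "map_prod w w ` inv_pairs (n + 1) x \<subseteq> ?P"
  proof -
    have "w p \<in> {1..n + 1} \<longleftrightarrow> p \<in> {1..n + 1}" "w p = w q \<longleftrightarrow> p = q" for p q
      using permutes_in_image[OF w] permutes_inj[OF w] by (simp_all add: inj_eq)
    then show ?thesis by (auto simp: inv_pairs_def simp del: atLeastAtMost_iff)
  qed
  have "A.act w ` A.inversions x = ?r ` map_prod w w ` inv_pairs (n + 1) x"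
    unfolding inversions_eq[OF x] image_image
    using act_root_vec[OF w] by (intro image_cong) (auto simp: inv_pairs_def)
  then have "A.act w ` A.inversions x = A.inversions y \<longleftrightarrow>
      map_prod w w ` inv_pairs (n + 1) x = inv_pairs (n + 1) y"
    using inj_on_image_eq_iff[OF inj subw sub] by (simp add: inversions_eq[OF y])
  moreover have "{w, x, y, z} \<subseteq> carrier (sym_group (n + 1)) - {\<one>\<^bsub>sym_group (n + 1)\<^esub>}"
    unfolding nontrivial_elements using True by blast
  ultimately have "A.coxeter_square w x y z \<longleftrightarrow> w \<circ> x = y \<circ> z \<and>
      map_prod w w ` inv_pairs (n + 1) x = inv_pairs (n + 1) y"
    unfolding A.coxeter_square_def sym_group_mult by (simp only: simp_thms)
  then show ?thesis unfolding eqTrueI[OF True] by (simp only: simp_thms)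
next
  case False
  then have "\<not> {w, x, y, z} \<subseteq> carrier (sym_group (n + 1)) - {\<one>\<^bsub>sym_group (n + 1)\<^esub>}"
    unfolding nontrivial_elements by blast
  then show ?thesis using False unfolding A.coxeter_square_def by blast
qed


section \<open>Edge labels are bigrassmannian\<close>

lemma coxeter_squareD:
  assumes "A.coxeter_square w x y z"
  shows "w permutes {1..n + 1}" "x permutes {1..n + 1}" "y permutes {1..n + 1}"
    "z permutes {1..n + 1}" "w (x k) = y (z k)"
    "(p, q) \<in> inv_pairs (n + 1) x \<Longrightarrow> (w p, w q) \<in> inv_pairs (n + 1) y"
    "(p, q) \<in> inv_pairs (n + 1) y \<Longrightarrow> \<exists>a b. (a, b) \<in> inv_pairs (n + 1) x \<and> p = w a \<and> q = w b"
proof -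
  note sq = assms[unfolded coxeter_square_iff]
  show "w permutes {1..n + 1}" "x permutes {1..n + 1}" "y permutes {1..n + 1}" "z permutes {1..n + 1}"
    using sq by simp_all
  show "w (x k) = y (z k)" using sq by (metis comp_apply)
  have im: "inv_pairs (n + 1) y = map_prod w w ` inv_pairs (n + 1) x" using sq by simp
  show "(p, q) \<in> inv_pairs (n + 1) x \<Longrightarrow> (w p, w q) \<in> inv_pairs (n + 1) y"
    unfolding im by (rule map_prod_imageI)
  show "\<exists>a b. (a, b) \<in> inv_pairs (n + 1) x \<and> p = w a \<and> q = w b" if "(p, q) \<in> inv_pairs (n + 1) y"
    using that unfolding im by auto
qed

text \<open>
  In a Coxeter square \<open>(w, x, y, z)\<close> the edges \<open>w\<close> and \<open>y\<close> enter the final vertex. A root in the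
  inversion set of \<open>y\<close> is \<open>w\<close> applied to a positive root, so the inverse of \<open>w\<close> does not make it
  negative.
\<close>

lemma square_disjoint_at_end:
  assumes "A.coxeter_square w x y z"
  shows "inv_pairs (n + 1) y \<inter> inv_pairs (n + 1) w = {}"
proof -
  note sq = coxeter_squareD[OF assms]
  have False if y: "(p, q) \<in> inv_pairs (n + 1) y" and w: "(p, q) \<in> inv_pairs (n + 1) w" for p q
  proof -
    obtain a b where "(a, b) \<in> inv_pairs (n + 1) x" "p = w a" "q = w b"
      using sq(7)[OF y] by blast
    then show False using w permutes_inverses(2)[OF sq(1)] by (simp add: inv_pairs_def)
  qed
  then show ?thesis by auto
qed

text \<open>
  At the intermediate vertex between \<open>x\<close> and \<open>w\<close>, the edge \<open>w\<close> is read backwards. The roots in the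
  inversion set of \<open>x\<close> are sent by \<open>w\<close> to inversions of \<open>y\<close>, which are positive.
\<close>

lemma square_disjoint_at_middle:
  assumes "A.coxeter_square w x y z"
  shows "inv_pairs (n + 1) x \<inter> inv_pairs (n + 1) (inv' w) = {}"
proof -
  note sq = coxeter_squareD[OF assms]
  have False if "(p, q) \<in> inv_pairs (n + 1) x" "(p, q) \<in> inv_pairs (n + 1) (inv' w)" for p q
    using sq(6)[OF that(1)] that(2) permutes_inv_inv[OF sq(1)] by (simp add: inv_pairs_def)
  then show ?thesis by auto
qed

text \<open>
  At the initial vertex both edges are read backwards. Suppose that \<open>x\<close> and \<open>z\<close> both make the
  positive root \<open>\<beta>\<close> negative. Then \<open>- x \<beta>\<close> is an inversion of \<open>x\<close>, so \<open>- w x \<beta> = - y z \<beta>\<close> is an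
  inversion of \<open>y\<close>. Hence the inverse of \<open>y\<close> maps it to the negative root \<open>- z \<beta>\<close>, although
  \<open>z \<beta>\<close> is negative.
\<close>

lemma square_disjoint_at_start:
  assumes "A.coxeter_square w x y z"
  shows "inv_pairs (n + 1) (inv' x) \<inter> inv_pairs (n + 1) (inv' z) = {}"
proof -
  note sq = coxeter_squareD[OF assms]
  have False if x: "(p, q) \<in> inv_pairs (n + 1) (inv' x)" and z: "(p, q) \<in> inv_pairs (n + 1) (inv' z)" for p q
  proof -
    have pq: "p \<in> {1..n + 1}" "q \<in> {1..n + 1}" "p < q" "x q < x p" "z q < z p"
      using x z permutes_inv_inv[OF sq(2)] permutes_inv_inv[OF sq(4)] by (auto simp: inv_pairs_def)
    have "x p \<in> {1..n + 1}" "x q \<in> {1..n + 1}"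
      using pq permutes_in_image[OF sq(2)] by blast+
    then have "(x q, x p) \<in> inv_pairs (n + 1) x"
      using pq permutes_inverses(2)[OF sq(2)] by (simp add: inv_pairs_def)
    then have "(y (z q), y (z p)) \<in> inv_pairs (n + 1) y"
      using sq(6) by (simp flip: sq(5))
    then show False
      using pq permutes_inverses(2)[OF sq(3)] by (simp add: inv_pairs_def)
  qed
  then show ?thesis by auto
qed

text \<open>
  The edge at the vertex \<open>v\<close> in direction \<open>i\<close>, read as an edge that ends in \<open>v\<close>. Reversing an edge
  inverts its label.
\<close>

definition label_towards :: "((nat \<Rightarrow> nat) \<times> nat \<Rightarrow> nat \<Rightarrow> nat) \<Rightarrow> (nat \<Rightarrow> nat) \<Rightarrow> nat \<Rightarrow> nat \<Rightarrow> nat" where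
  "label_towards lab v i = (if v i = 1 then lab (v(i := 0), i) else inv' (lab (v, i)))"

text \<open>
  The vertex \<open>v\<close> is one of the four corners of the face spanned by the directions \<open>i\<close> and \<open>j\<close>. The
  coordinates of \<open>v\<close> in these directions tell which of the three disjointness lemmas applies.
\<close>

lemma labels_towards_disjoint:
  assumes cube: "A.coxeter_cube n lab" and v: "v \<in> cube_vertices n"
    and i: "i \<in> {1..n}" and j: "j \<in> {1..n}" and ij: "i \<noteq> j"
  shows "inv_pairs (n + 1) (label_towards lab v i) \<inter> inv_pairs (n + 1) (label_towards lab v j) = {}"
proof -
  define u where "u = v(i := 0, j := 0)"
  have u: "u \<in> cube_vertices n" "u i = 0" "u j = 0"
    using v i j by (auto simp: u_def cube_vertices_def PiE_iff extensional_def)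
  note squares = conjunct2[OF cube[unfolded A.coxeter_cube_def], rule_format, OF u(1)]
  have sq: "A.coxeter_square (lab (u(i := 1), j)) (lab (u, i)) (lab (u(j := 1), i)) (lab (u, j))"
    by (rule squares[OF i j ij u(2,3)])
  have sq': "A.coxeter_square (lab (u(j := 1), i)) (lab (u, j)) (lab (u(i := 1), j)) (lab (u, i))"
    by (rule squares[OF j i ij[symmetric] u(3,2)])
  have "v i \<in> {0, 1}" "v j \<in> {0, 1}"
    using v i j by (auto simp: cube_vertices_def simp del: atLeastAtMost_iff)
  then consider (11) "v i = 1" "v j = 1" | (10) "v i = 1" "v j = 0"
    | (01) "v i = 0" "v j = 1" | (00) "v i = 0" "v j = 0" by auto
  then show ?thesis
  proof cases
    case 11
    then have "v(i := 0) = u(j := 1)" "v(j := 0) = u(i := 1)"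
      using ij by (auto simp: u_def fun_eq_iff)
    then show ?thesis using 11 square_disjoint_at_end[OF sq] by (simp add: label_towards_def)
  next
    case 10
    then have "v(i := 0) = u" "v = u(i := 1)"
      using ij by (auto simp: u_def fun_eq_iff)
    then show ?thesis using 10 square_disjoint_at_middle[OF sq] by (simp add: label_towards_def)
  next
    case 01
    then have "v(j := 0) = u" "v = u(j := 1)"
      using ij by (auto simp: u_def fun_eq_iff)
    then show ?thesis
      using 01 square_disjoint_at_middle[OF sq'] by (simp add: label_towards_def Int_commute)
  next
    case 00
    then have "v = u"
      using ij by (auto simp: u_def fun_eq_iff)
    then show ?thesis using 00 square_disjoint_at_start[OF sq] by (simp add: label_towards_def)
  qed
qed

lemma label_towards_nontrivial:
  assumes cube: "A.coxeter_cube n lab" and v: "v \<in> cube_vertices n" and i: "i \<in> {1..n}"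
  shows "label_towards lab v i permutes {1..n + 1}" "label_towards lab v i \<noteq> id"
proof -
  have lab: "lab (w, i) permutes {1..n + 1} \<and> lab (w, i) \<noteq> id"
    if "w \<in> cube_vertices n" "w i = 0" for w
  proof -
    have "(w, i) \<in> cube_edges n" using that i by (simp add: cube_edges_def)
    then have "lab (w, i) \<in> carrier (sym_group (n + 1)) - {\<one>\<^bsub>sym_group (n + 1)\<^esub>}"
      using cube unfolding A.coxeter_cube_def by blast
    then show ?thesis unfolding nontrivial_elements by blast
  qed
  have "label_towards lab v i permutes {1..n + 1} \<and> label_towards lab v i \<noteq> id"
  proof (cases "v i = 1")
    case True
    have "v(i := 0) \<in> cube_vertices n"
      using v i by (auto simp: cube_vertices_def PiE_iff extensional_def)
    then show ?thesis using True lab by (simp add: label_towards_def)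
  next
    case False
    then have "v i = 0" using v i by (auto simp: cube_vertices_def PiE_iff)
    then have "lab (v, i) permutes {1..n + 1}" "lab (v, i) \<noteq> id" using lab v by blast+
    then have "inv' (lab (v, i)) permutes {1..n + 1}" "inv' (lab (v, i)) \<noteq> id"
      using permutes_inv permutes_inv_inv by (blast, metis inv_id)
    then show ?thesis using False by (simp add: label_towards_def)
  qed
  then show "label_towards lab v i permutes {1..n + 1}" "label_towards lab v i \<noteq> id" by blast+
qed

lemma label_towards_unique_descent:
  assumes cube: "A.coxeter_cube n lab" and v: "v \<in> cube_vertices n" and i: "i \<in> {1..n}"
  shows "\<exists>!k. k \<in> {1..n} \<and> inv' (label_towards lab v i) (k + 1) < inv' (label_towards lab v i) k"
proof -
  define D where "D i = {k \<in> {1..n}. (k, k + 1) \<in> inv_pairs (n + 1) (label_towards lab v i)}" for i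
  have D: "D i = {k \<in> {1..n}. inv' (label_towards lab v i) (k + 1) < inv' (label_towards lab v i) k}" for i
    by (auto simp: D_def inv_pairs_def)
  \<comment> \<open>The simple roots in the \<open>n\<close> disjoint inversion sets at \<open>v\<close> are distributed among \<open>n\<close> directions.\<close>
  have "card (D i) = 1"
  proof (rule card_eq_1_if_disjoint[of "{1..n}" "{1..n}" D])
    fix j assume j: "j \<in> {1..n}"
    note a = label_towards_nontrivial[OF cube v j]
    have "inv' (label_towards lab v j) \<noteq> id" using a permutes_inv_inv inv_id by metis
    then show "D j \<noteq> {}" unfolding D using permutes_has_descent[OF permutes_inv[OF a(1)]] by blast
  next
    fix j k assume "j \<in> {1..n}" "k \<in> {1..n}" "j \<noteq> k"
    from labels_towards_disjoint[OF cube v this]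
    show "D j \<inter> D k = {}" unfolding D_def by blast
  qed (use i in \<open>auto simp: D_def\<close>)
  then obtain k where "D i = {k}" by (rule card_1_singletonE)
  then show ?thesis unfolding D by (intro ex1I[of _ k]) blast+
qed

lemma edge_label_bigrassmannian:
  assumes cube: "A.coxeter_cube n lab" and e: "(v, i) \<in> cube_edges n"
  shows "bigrassmannian n (lab (v, i))"
proof -
  let ?x = "lab (v, i)"
  have v: "v \<in> cube_vertices n" "v i = 0" and i: "i \<in> {1..n}" using e by (auto simp: cube_edges_def)
  have v1: "v(i := 1) \<in> cube_vertices n"
    using v i by (auto simp: cube_vertices_def PiE_iff extensional_def)
  have "v(i := 0) = v" using v by auto
  then have head: "label_towards lab (v(i := 1)) i = ?x" by (simp add: label_towards_def)
  have tail: "label_towards lab v i = inv' ?x" using v by (simp add: label_towards_def)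
  have x: "?x permutes {1..n + 1}" using label_towards_nontrivial(1)[OF cube v1 i] by (simp only: head)
  obtain j where j: "j \<in> {1..n}" "inv' ?x (j + 1) < inv' ?x j"
    and j': "\<And>k. k \<in> {1..n} \<Longrightarrow> inv' ?x (k + 1) < inv' ?x k \<Longrightarrow> k = j"
    using label_towards_unique_descent[OF cube v1 i] unfolding head by blast
  obtain k where k: "k \<in> {1..n}" "?x (k + 1) < ?x k"
    and k': "\<And>l. l \<in> {1..n} \<Longrightarrow> ?x (l + 1) < ?x l \<Longrightarrow> l = k"
    using label_towards_unique_descent[OF cube v(1) i] unfolding tail permutes_inv_inv[OF x] by blast
  have "\<exists>!p. p \<in> {1..n} \<times> {1..n} \<and>
      (case p of (a, b) \<Rightarrow> ?x a > ?x (a + 1) \<and> inv' ?x b > inv' ?x (b + 1))"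
    (is "\<exists>!p. ?Q p")
  proof (rule ex1I[of _ "(k, j)"])
    show "?Q (k, j)" using j k by simp
    fix p assume Q: "?Q p"
    obtain a b where p: "p = (a, b)" by (cases p)
    have "a = k" by (rule k') (use Q in \<open>auto simp: p\<close>)
    moreover have "b = j" by (rule j') (use Q in \<open>auto simp: p\<close>)
    ultimately show "p = (k, j)" by (simp add: p)
  qed
  then show ?thesis unfolding bigrassmannian_def using x by blast
qed


section \<open>Bigrassmannian permutations are edge labels\<close>

text \<open>
  Let \<open>i\<close> and \<open>j\<close> be the unique descents of \<open>x\<close> and of its inverse \<open>y\<close>. As \<open>y\<close> increases up to \<open>j\<close> and
  again after \<open>j\<close>, an inversion \<open>p < q\<close> has \<open>p \<le> j < q\<close>; as \<open>x\<close> increases up to \<open>i\<close> and again after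
  \<open>i\<close>, it has \<open>y q \<le> i < y p\<close>. By monotonicity the condition \<open>i < y p\<close> cuts out a final
  segment of \<open>1, ..., j\<close>, and \<open>y q \<le> i\<close> an initial segment of \<open>j + 1, ..., n + 1\<close>.
\<close>

lemma bigrassmannian_rectangle:
  assumes x: "bigrassmannian n x"
  shows "\<exists>s j t. s \<le> j \<and> j < t \<and> j \<in> {1..n} \<and>
    (\<forall>p\<in>{1..n + 1}. \<forall>q\<in>{1..n + 1}. p < q \<longrightarrow>
      (inv' x q < inv' x p \<longleftrightarrow> s \<le> p \<and> p \<le> j \<and> j < q \<and> q \<le> t))"
proof -
  define y where "y = inv' x"
  have px: "x permutes {1..n + 1}" using x by (simp add: bigrassmannian_def)
  then have py: "y permutes {1..n + 1}" unfolding y_def by (rule permutes_inv)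
  have xy: "x (y p) = p" for p using permutes_inverses(1)[OF px] by (simp add: y_def)
  have in_range: "y p \<in> {1..n + 1}" if "p \<in> {1..n + 1}" for p
    using permutes_in_image[OF py] that by blast
  obtain i j where i: "i \<in> {1..n}" "x (i + 1) < x i" and j: "j \<in> {1..n}" "y (j + 1) < y j"
    and unique: "\<And>k l. k \<in> {1..n} \<Longrightarrow> l \<in> {1..n} \<Longrightarrow> x (k + 1) < x k \<Longrightarrow> y (l + 1) < y l \<Longrightarrow> k = i \<and> l = j"
  proof -
    let ?Q = "\<lambda>e. e \<in> {1..n} \<times> {1..n} \<and> (case e of (i, j) \<Rightarrow> x i > x (i + 1) \<and> y j > y (j + 1))"
    have "\<exists>!e. ?Q e" using x unfolding bigrassmannian_def y_def by (rule conjunct2)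
    then obtain e where e: "?Q e" and e_unique: "\<And>e'. ?Q e' \<Longrightarrow> e' = e" by (elim ex1E) blast
    obtain i j where ij: "e = (i, j)" by (cases e)
    show thesis
    proof (rule that[of i j])
      fix k l assume "k \<in> {1..n}" "l \<in> {1..n}" "x (k + 1) < x k" "y (l + 1) < y l"
      then have "(k, l) = e" by (intro e_unique) simp
      then show "k = i \<and> l = j" by (simp add: ij)
    qed (use e in \<open>simp_all add: ij\<close>)
  qed
  have mono_x: "x p < x q" if "p < q" "1 \<le> p" "q \<le> n + 1" "i < p \<or> q \<le> i" for p q
  proof (rule less_if_no_descent[OF permutes_inj[OF px] _ order_refl that(1) order_refl])
    fix k assume "p \<le> k" "k < q"
    then have "k \<in> {1..n}" "k \<noteq> i" using that by auto
    then show "\<not> x (k + 1) < x k" using unique[of k j] j by auto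
  qed
  have mono_y: "y p < y q" if "p < q" "1 \<le> p" "q \<le> n + 1" "j < p \<or> q \<le> j" for p q
  proof (rule less_if_no_descent[OF permutes_inj[OF py] _ order_refl that(1) order_refl])
    fix k assume "p \<le> k" "k < q"
    then have "k \<in> {1..n}" "k \<noteq> j" using that by auto
    then show "\<not> y (k + 1) < y k" using unique[of i k] i by auto
  qed
  have inv_iff: "y q < y p \<longleftrightarrow> p \<le> j \<and> i < y p \<and> j < q \<and> y q \<le> i"
    if p: "p \<in> {1..n + 1}" and q: "q \<in> {1..n + 1}" and "p < q" for p q
  proof
    assume inv: "y q < y p"
    then have "p \<le> j \<and> j < q" using mono_y[of p q] p q \<open>p < q\<close> by (metis atLeastAtMost_iff leI less_asym)
    moreover have "i < y p \<and> y q \<le> i"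
      using mono_x[OF inv] in_range[OF p] in_range[OF q] \<open>p < q\<close> by (fastforce simp: xy)
    ultimately show "p \<le> j \<and> i < y p \<and> j < q \<and> y q \<le> i" by blast
  qed auto
  define S where "S = {p \<in> {1..j}. i < y p}"
  define U where "U = {q \<in> {j + 1..n + 1}. y q \<le> i}"
  have jS: "j \<in> S" and jU: "j + 1 \<in> U"
    using inv_iff[of j "j + 1"] j by (auto simp: S_def U_def)
  have fin: "finite S" "finite U" by (simp_all add: S_def U_def)
  have S: "Min S \<in> S" and U: "Max U \<in> U" using fin jS jU by (auto intro: Min_in Max_in)
  have S_iff: "i < y p \<longleftrightarrow> Min S \<le> p" if "1 \<le> p" "p \<le> j" for p
  proof
    assume "i < y p"
    then show "Min S \<le> p" using that fin by (intro Min_le) (auto simp: S_def)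
  next
    assume "Min S \<le> p"
    then show "i < y p" using S that j mono_y[of "Min S" p] by (cases "p = Min S") (auto simp: S_def)
  qed
  have U_iff: "y q \<le> i \<longleftrightarrow> q \<le> Max U" if "j < q" "q \<le> n + 1" for q
  proof
    assume "y q \<le> i"
    then show "q \<le> Max U" using that fin by (intro Max_ge) (auto simp: U_def)
  next
    assume "q \<le> Max U"
    then show "y q \<le> i" using U that j mono_y[of q "Max U"] by (cases "q = Max U") (auto simp: U_def)
  qed
  have "y q < y p \<longleftrightarrow> Min S \<le> p \<and> p \<le> j \<and> j < q \<and> q \<le> Max U"
    if "p \<in> {1..n + 1}" "q \<in> {1..n + 1}" "p < q" for p q
    using inv_iff[OF that] S_iff[of p] U_iff[of q] that by auto
  moreover have "Min S \<le> j" "j < Max U" using S U by (auto simp: S_def U_def)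
  ultimately show ?thesis using j unfolding y_def by blast
qed

text \<open>
  Two permutations \<open>f\<close> and \<open>g\<close> arrange the same indices in two ways. The inversions of \<open>f \<circ> inv' g\<close>
  are the pairs of indices about whose order \<open>f\<close> and \<open>g\<close> disagree, given by their ranks under \<open>f\<close>.
\<close>

lemma inv_pairs_comp_inv:
  assumes f: "f permutes {1..m}" and g: "g permutes {1..m}"
  shows "inv_pairs m (f \<circ> inv' g) =
    map_prod f f ` {(a, b). a \<in> {1..m} \<and> b \<in> {1..m} \<and> f a < f b \<and> g b < g a}"
proof -
  have inv: "inv' (f \<circ> inv' g) p = g (inv' f p)" for p
    using o_inv_distrib[OF permutes_bij[OF f] permutes_bij[OF permutes_inv[OF g]]]
    by (simp add: permutes_inv_inv[OF g])
  have in_range: "f p \<in> {1..m} \<longleftrightarrow> p \<in> {1..m}" for p by (rule permutes_in_image[OF f])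
  have ff: "inv' f (f p) = p" "f (inv' f p) = p" for p using permutes_inverses[OF f] by auto
  show ?thesis
  proof (intro equalityI subsetI)
    fix z assume z: "z \<in> inv_pairs m (f \<circ> inv' g)"
    obtain p q where pq: "z = (f p, f q)" using ff(2) by (metis surj_pair)
    show "z \<in> map_prod f f ` {(a, b). a \<in> {1..m} \<and> b \<in> {1..m} \<and> f a < f b \<and> g b < g a}"
      using z unfolding pq by (intro image_eqI[of _ _ "(p, q)"])
        (simp_all add: inv_pairs_def inv ff in_range del: atLeastAtMost_iff)
  next
    fix z assume "z \<in> map_prod f f ` {(a, b). a \<in> {1..m} \<and> b \<in> {1..m} \<and> f a < f b \<and> g b < g a}"
    then show "z \<in> inv_pairs m (f \<circ> inv' g)"
      by (auto simp add: inv_pairs_def inv ff in_range simp del: atLeastAtMost_iff)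
  qed
qed

text \<open>
  For \<open>p < q\<close> think of \<open>c p q\<close> as the node of a binary tree at which the leaves \<open>p\<close> and \<open>q\<close> separate,
  where node \<open>i\<close> lies between the leaves \<open>i\<close> and \<open>i + 1\<close>. The tree enters only through these two
  properties of \<open>c\<close>. The second one says that of three leaves two stay together
  when the third is split off. It makes the set of pairs separated at nodes in \<open>T\<close> as well as its
  complement transitive, so reversing exactly these pairs yields a linear order for each \<open>T\<close>.
\<close>

lemma edge_label_of_separation:
  fixes c :: "nat \<Rightarrow> nat \<Rightarrow> nat"
  assumes adj: "\<And>i. i \<in> {1..n} \<Longrightarrow> c i (i + 1) = i"
    and split: "\<And>p q r. 1 \<le> p \<Longrightarrow> p < q \<Longrightarrow> q < r \<Longrightarrow> r \<le> n + 1 \<Longrightarrow> c p r \<in> {c p q, c q r}"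
    and j: "j \<in> {1..n}" and x: "x permutes {1..n + 1}"
    and inv_x: "\<And>p q. p \<in> {1..n + 1} \<Longrightarrow> q \<in> {1..n + 1} \<Longrightarrow> p < q \<Longrightarrow> inv' x q < inv' x p \<longleftrightarrow> c p q = j"
  shows "\<exists>lab. A.coxeter_cube n lab \<and> (\<exists>e\<in>cube_edges n. x = lab e)"
proof -
  \<comment> \<open>\<open>R T\<close> is the order of the leaves after exchanging the children at the nodes in \<open>T\<close>,
    and \<open>r T\<close> gives the rank of each leaf in it.\<close>
  define R where "R T p q \<longleftrightarrow> (p < q \<and> c p q \<notin> T) \<or> (q < p \<and> c q p \<in> T)" for T p q
  have in_T: "c p r \<in> T" if "1 \<le> p" "p < q" "q < r" "r \<le> n + 1" "c p q \<in> T" "c q r \<in> T" for T p q r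
    using split[OF that(1-4)] that(5,6) by auto
  have notin_T: "c p r \<notin> T" if "1 \<le> p" "p < q" "q < r" "r \<le> n + 1" "c p q \<notin> T" "c q r \<notin> T" for T p q r
    using split[OF that(1-4)] that(5,6) by auto
  have "\<exists>f. f permutes {1..n + 1} \<and> (\<forall>p\<in>{1..n + 1}. \<forall>q\<in>{1..n + 1}. f p < f q \<longleftrightarrow> R T p q)" for T
  proof (rule ex_permutes_of_order)
    fix p q r assume "p \<in> {1..n + 1}" "q \<in> {1..n + 1}" "r \<in> {1..n + 1}" and R: "R T p q" "R T q r"
    then have *: "1 \<le> p" "1 \<le> q" "1 \<le> r" "p \<le> n + 1" "q \<le> n + 1" "r \<le> n + 1" by auto
    have ne: "p \<noteq> q" "q \<noteq> r" "p \<noteq> r" using R by (auto simp: R_def)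
    consider "p < q" "q < r" | "p < r" "r < q" | "q < p" "p < r" | "q < r" "r < p"
      | "r < p" "p < q" | "r < q" "q < p"
      using ne by linarith
    then show "R T p r"
    proof cases
      case 1 then show ?thesis using R * notin_T[of p q r T] by (simp add: R_def)
    next
      case 2 then show ?thesis using R * in_T[of p r q T] by (auto simp: R_def)
    next
      case 3 then show ?thesis using R * in_T[of q p r T] by (auto simp: R_def)
    next
      case 4 then show ?thesis using R * notin_T[of q r p T] by (auto simp: R_def)
    next
      case 5 then show ?thesis using R * notin_T[of r p q T] by (auto simp: R_def)
    next
      case 6 then show ?thesis using R * in_T[of r q p T] by (simp add: R_def)
    qed
  qed (auto simp: R_def)
  then obtain r where r: "\<And>T. r T permutes {1..n + 1}"
    and r_less: "\<And>T p q. p \<in> {1..n + 1} \<Longrightarrow> q \<in> {1..n + 1} \<Longrightarrow> r T p < r T q \<longleftrightarrow> R T p q"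
    by metis
  define N where "N i = {(a, b). a \<in> {1..n + 1} \<and> b \<in> {1..n + 1} \<and> a < b \<and> c a b = i}" for i
  define edge where "edge T i = r T \<circ> inv' (r (insert i T))" for T i
  have perm: "edge T i permutes {1..n + 1}" for T i
    unfolding edge_def by (intro permutes_compose permutes_inv r)
  \<comment> \<open>The orders for \<open>T\<close> and \<open>insert i T\<close> disagree exactly about the pairs separated at node \<open>i\<close>,
    and \<open>R T\<close> keeps these in their natural order because \<open>i\<close> is not in \<open>T\<close>.\<close>
  have inv_edge: "inv_pairs (n + 1) (edge T i) = map_prod (r T) (r T) ` N i" if "i \<notin> T" for T i
  proof -
    have "{(a, b). a \<in> {1..n + 1} \<and> b \<in> {1..n + 1} \<and> r T a < r T b \<and> r (insert i T) b < r (insert i T) a}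
        = N i"
      unfolding N_def using that by (auto simp: r_less R_def simp del: atLeastAtMost_iff)
    then show ?thesis unfolding edge_def by (simp add: inv_pairs_comp_inv[OF r r])
  qed
  have nontrivial: "edge T i \<noteq> id" if "i \<in> {1..n}" "i \<notin> T" for T i
  proof
    assume "edge T i = id"
    moreover have "inv_pairs (n + 1) id = {}" by (auto simp: inv_pairs_def)
    moreover have "(i, i + 1) \<in> N i" using that adj by (auto simp: N_def)
    ultimately show False using inv_edge[OF \<open>i \<notin> T\<close>] by auto
  qed
  \<comment> \<open>Parallel edges in direction \<open>i\<close> share the set \<open>N i\<close> of pairs; only the ranks in which it is
    expressed differ, and \<open>edge T k\<close> converts the ranks at one end into those at the other.\<close>
  have square: "A.coxeter_square (edge T k) (edge (insert k T) i) (edge T i) (edge (insert i T) k)"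
    if "i \<in> {1..n}" "k \<in> {1..n}" "i \<noteq> k" "i \<notin> T" "k \<notin> T" for T i k
  proof -
    have comp: "edge T k \<circ> r (insert k T) = r T" for T k
      using permutes_inv_o(2)[OF r] unfolding edge_def by (simp add: o_assoc[symmetric])
    have "edge T k \<circ> edge (insert k T) i = r T \<circ> inv' (r (insert i (insert k T)))"
      using comp[of T k] unfolding edge_def[of "insert k T"] by (simp add: o_assoc)
    moreover have "edge T i \<circ> edge (insert i T) k = r T \<circ> inv' (r (insert i (insert k T)))"
      using comp[of T i] unfolding edge_def[of "insert i T"] by (simp add: o_assoc insert_commute)
    moreover have "map_prod (edge T k) (edge T k) ` inv_pairs (n + 1) (edge (insert k T) i) =
        inv_pairs (n + 1) (edge T i)"
      using that by (simp add: inv_edge image_comp map_prod.comp comp)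
    ultimately show ?thesis
      unfolding coxeter_square_iff using that perm nontrivial by auto
  qed
  \<comment> \<open>A vertex stands for the set of its zero coordinates, so the final vertex is the unpermuted
    arrangement.\<close>
  define Z where "Z v = {k \<in> {1..n}. v k = (0::nat)}" for v
  define lab where "lab = (\<lambda>(v, i). edge (Z v - {i}) i)"
  have "A.coxeter_cube n lab"
    unfolding A.coxeter_cube_def
  proof (intro conjI ballI impI)
    fix e assume "e \<in> cube_edges n"
    then obtain v i where "e = (v, i)" "i \<in> {1..n}" by (auto simp: cube_edges_def)
    then show "lab e \<in> carrier (sym_group (n + 1)) - {\<one>\<^bsub>sym_group (n + 1)\<^esub>}"
      unfolding nontrivial_elements using perm nontrivial by (simp add: lab_def)
  next
    fix v i k assume "v \<in> cube_vertices n" and ik: "i \<in> {1..n}" "k \<in> {1..n}" "i \<noteq> k" "v i = 0" "v k = 0"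
    define T where "T = Z v - {i, k}"
    have "Z (v(i := 1)) - {k} = T" "Z v - {i} = insert k T" "Z (v(k := 1)) - {i} = T" "Z v - {k} = insert i T"
      using ik by (auto simp: Z_def T_def)
    then show "A.coxeter_square (lab (v(i := 1), k)) (lab (v, i)) (lab (v(k := 1), i)) (lab (v, k))"
      using square[OF ik(1-3), of T] by (simp add: lab_def T_def)
  qed
  moreover have "\<exists>e\<in>cube_edges n. x = lab e"
  proof
    define v where "v = (\<lambda>k\<in>{1..n}. if k = j then 0 else 1 :: nat)"
    show "(v, j) \<in> cube_edges n"
      using j by (auto simp: cube_edges_def cube_vertices_def v_def)
    \<comment> \<open>This edge leads from the set \<open>{j}\<close> to the empty set.\<close>
    have "r {} = id"
      by (rule permutes_eqI_order[OF r permutes_id]) (auto simp: r_less R_def simp del: atLeastAtMost_iff)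
    moreover have "r {j} = inv' x"
      by (rule permutes_eqI_order[OF r permutes_inv[OF x]])
        (auto simp: r_less R_def inv_x simp del: atLeastAtMost_iff)
    moreover have "Z v - {j} = {}" using j by (auto simp: Z_def v_def)
    then have "lab (v, j) = edge {} j" by (simp only: lab_def prod.case)
    ultimately show "x = lab (v, j)"
      by (simp add: edge_def permutes_inv_inv[OF x])
  qed
  ultimately show ?thesis by blast
qed

text \<open>
  The tree splits off the leaves \<open>p < s\<close> one by one from the left and then the leaves \<open>q > t\<close> one by
  one from the right. It separates the remaining leaves at \<open>j\<close>, and below that node it again splits
  off one leaf at a time from the left.
\<close>

lemma bigrassmannian_edge_label:
  assumes x: "bigrassmannian n x"
  shows "\<exists>lab. A.coxeter_cube n lab \<and> (\<exists>e\<in>cube_edges n. x = lab e)"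
proof -
  obtain s j t where sjt: "s \<le> j" "j < t" "j \<in> {1..n}"
    and rect: "\<And>p q. p \<in> {1..n + 1} \<Longrightarrow> q \<in> {1..n + 1} \<Longrightarrow> p < q \<Longrightarrow>
      inv' x q < inv' x p \<longleftrightarrow> s \<le> p \<and> p \<le> j \<and> j < q \<and> q \<le> t"
    using bigrassmannian_rectangle[OF x] by metis
  define c where "c p q = (if p < s then p else if t < q then q - 1 else if p \<le> j \<and> j < q then j else p)" for p q
  show ?thesis
  proof (rule edge_label_of_separation[of c j])
    show "c i (i + 1) = i" for i using sjt by (auto simp: c_def)
    show "c p r \<in> {c p q, c q r}" if "p < q" "q < r" for p q r
      using that sjt by (auto simp: c_def)
    show "inv' x q < inv' x p \<longleftrightarrow> c p q = j" if "p \<in> {1..n + 1}" "q \<in> {1..n + 1}" "p < q" for p q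
      unfolding rect[OF that] using that sjt by (auto simp: c_def)
    show "x permutes {1..n + 1}" using x by (simp add: bigrassmannian_def)
  qed (rule sjt)
qed

lemma edge_iff_bigrassmannian: "x \<in> Edge n \<longleftrightarrow> bigrassmannian n x"
  unfolding Edge_def A.cube_labels_def
  using edge_label_bigrassmannian bigrassmannian_edge_label by fastforce

end

theorem theorem5p33:
  fixes n :: nat and x :: "nat \<Rightarrow> nat"
  assumes "n \<ge> 1"
    and "x \<in> carrier (sym_group (n + 1))"
  shows "x \<in> Edge n \<longleftrightarrow> bigrassmannian n x"
  by (rule edge_iff_bigrassmannian)

end
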